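(* Let $N\ge2$, let $A\subset\mathbb{R}^N$ be open, and let $\kappa\colon[0,\infty)\to\mathbb{R}$ be a $C^1$ function satisfying ($\kappa1$) $\lim_{r\to\infty}\kappa(r)=0$ and $\int_{\mathbb{R}^N}|\kappa(\|x\|^2)|\,dx<\infty$; ($\kappa2$) $\lim_{r\to\infty}r\kappa'(r^2)=0$ and $\int_{\mathbb{R}^N}\sup_{b\in K}\big(\|x+b\|\,|\kappa'(\|x+b\|^2)|\big)\,dx<\infty$ for every compact $K\subset\mathbb{R}^N$. For $t>0$, $x\in\mathbb{R}^N$ put $h(t,x)=\int_{A}t^{-N/2}\kappa(\|x-y\|^2/t)\,dy$. Let $0<\alpha\le1$ and let $p\in\partial A$ be a $C^{1,\alpha}$-corner of $A$, with $A$ described in a neighborhood $U$ of $p$ by $C^{1,\alpha}$-functions $g_1,\dots,g_k\colon U\to\mathbb{R}$ and a partition $\{1,\dots,k\}=I_1\cup\dots\cup I_m$ as $$A\cap U=\bigcup_{j=1}^m\{x\in U:g_i(x)>0\text{ for all }i\in I_j\}.$$ Then $$C=\bigcup_{j=1}^m\{x\in\mathbb{R}^N:(\nabla g_i(p),x-p)>0\text{ for all }i\in I_j\}$$ is an approximating cone of $A$ at $p$, and hence $$\nabla_xh(t,p)=-\frac{2}{\sqrt t}\left(\int_{C-p}z\,\kappa'(\|z\|^2)\,dz+o(1)\right)\quad\text{as }t\to0^+.$$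
   Context: $(\cdot,\cdot)$ is the standard inner product of $\mathbb{R}^N$. Corner: let $p\in\partial A$ and $0<\alpha\le 1$. Suppose there are a neighborhood $U\subseteq\mathbb{R}^N$ of $p$, $C^{1,\alpha}$-functions $g_i\colon U\to\mathbb{R}$, $i=1,\dots,k$, and a partition of $\{1,\dots,k\}$ into disjoint sets $I_1,\dots,I_m$ such that $g_i(p)=0$ for all $i$ and $A\cap U=\bigcup_{j=1}^m\{x\in U:g_i(x)>0\text{ for all }i\in I_j\}$. Then $p$ is a $C^{1,\alpha}$-corner of $A$ if (C1) there is $\ell\in\mathbb{R}^N$ with $(\nabla g_i(p),\ell)>0$ for all $1\le i\le k$; and (C2) for any $i\ne j$, $\nabla g_i(p)$ and $\nabla g_j(p)$ are linearly independent. Cone: $C\subset\mathbb{R}^N$ is a cone at $p$ if for every $z\in C-p$ the half-line $\{tz:t>0\}$ is contained in $C-p$. Approximating cone: an open cone $C$ at $p\in\partial A$ is an approximating cone of $A$ at $p$ if there is a function $R\colon(0,1)\to(0,\infty)$ with $\lim_{t\to0^+}R(t)=\infty$, $\lim_{t\to0^+}\sqrt t\,R(t)=0$ and $\lim_{t\to0^+}t^{-N/2}|U_t\,\Delta\,V_t|=0$, where $U_t=\{w\in A-p:\|w\|\le\sqrt t\,R(t)\}$, $V_t=\{w\in C-p:\|w\|\le\sqrt t\,R(t)\}$, $|\cdot|$ is Lebesgue measure and $\Delta$ is symmetric difference. The term $o(1)$ is $\mathbb{R}^N$-valued and tends to $0$. Condition ($\kappa2$) ensures that $h(t,\cdot)$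 is differentiable, with gradient obtained by differentiating under the integral. *)

theory Defs
  imports "HOL-Analysis.Analysis"
begin

definition grad :: "('a::real_inner \<Rightarrow> real) \<Rightarrow> 'a \<Rightarrow> 'a"
  where "grad f x = (THE D. GDERIV f x :> D)"

lemma grad_eqI:
  assumes "GDERIV f x :> D"
  shows "grad f x = D"
  unfolding grad_def
proof (rule the_equality[where P = "\<lambda>D. GDERIV f x :> D", OF assms])
  fix D'
  assume "GDERIV f x :> D'"
  with assms have "(\<lambda>h. h \<bullet> D') = (\<lambda>h. h \<bullet> D)"
    unfolding gderiv_def by (intro has_derivative_unique)
  then have "\<forall>h. h \<bullet> D' = h \<bullet> D"
    by (simp add: fun_eq_iff)
  then show "D' = D"
    by (simp only: vector_eq_ldot)
qed

text \<open>
  Class \<open>C\<^sup>1\<^sup>,\<^sup>\<alpha>\<close> on an open set \<open>U\<close>. The Hoelder condition on the gradient is the local one,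
  which is weaker than uniform Hoelder continuity on \<open>U\<close>; it implies continuity of the gradient
  for \<open>\<alpha> > 0\<close>.
\<close>

definition C1_holder_on :: "'a::real_inner set \<Rightarrow> real \<Rightarrow> ('a \<Rightarrow> real) \<Rightarrow> bool"
  where "C1_holder_on U \<alpha> f \<longleftrightarrow>
    (\<forall>x\<in>U. \<exists>D. GDERIV f x :> D) \<and>
    (\<forall>x0\<in>U. \<exists>r>0. \<exists>L. \<forall>x \<in> U \<inter> ball x0 r. \<forall>y \<in> U \<inter> ball x0 r.
        norm (grad f x - grad f y) \<le> L * norm (x - y) powr \<alpha>)"

text \<open>
  A point \<open>p\<close> is a \<open>C\<^sup>1\<^sup>,\<^sup>\<alpha>\<close>-corner of \<open>A\<close> iff such data \<open>U, g, k, I, m\<close> exist. The blocks \<open>I j\<close> need not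
  be assumed nonempty: an empty block would give \<open>U \<subseteq> A\<close>, contradicting \<open>p \<in> frontier A\<close>.
  The inequation in the last conjunct is needed because \<open>independent {v, v}\<close> only says \<open>v \<noteq> 0\<close>.
\<close>

definition corner_data ::
  "real \<Rightarrow> 'a::real_inner set \<Rightarrow> 'a \<Rightarrow> 'a set \<Rightarrow> (nat \<Rightarrow> 'a \<Rightarrow> real) \<Rightarrow> nat \<Rightarrow> (nat \<Rightarrow> nat set) \<Rightarrow> nat \<Rightarrow> bool"
  where "corner_data \<alpha> A p U g k I m \<longleftrightarrow>
    p \<in> frontier A \<and> open U \<and> p \<in> U \<and>
    (\<forall>i\<in>{1..k}. C1_holder_on U \<alpha> (g i) \<and> g i p = 0) \<and>
    (\<Union>j\<in>{1..m}. I j) = {1..k} \<and> disjoint_family_on I {1..m} \<and>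
    A \<inter> U = (\<Union>j\<in>{1..m}. {x\<in>U. \<forall>i\<in>I j. g i x > 0}) \<and>
    (\<exists>l. \<forall>i\<in>{1..k}. grad (g i) p \<bullet> l > 0) \<and>
    (\<forall>i\<in>{1..k}. \<forall>j\<in>{1..k}. i \<noteq> j \<longrightarrow>
        grad (g i) p \<noteq> grad (g j) p \<and> independent {grad (g i) p, grad (g j) p})"

definition translate_to_origin :: "'a::ab_group_add \<Rightarrow> 'a set \<Rightarrow> 'a set"
  where "translate_to_origin p S = (\<lambda>x. x - p) ` S"

text \<open>
  Unlike in the library predicates \<open>cone\<close> and \<open>conic\<close>, the apex need not belong to the set.
\<close>

definition cone_at :: "'a::real_vector \<Rightarrow> 'a set \<Rightarrow> bool"
  where "cone_at p C \<longleftrightarrow>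
    (\<forall>z\<in>translate_to_origin p C. {s *\<^sub>R z | s. s > 0} \<subseteq> translate_to_origin p C)"

text \<open>
  The function \<open>R\<close> is only relevant on the interval from 0 to 1. The truncated sets are bounded,
  and measurable if \<open>A\<close> is, so \<open>measure\<close> is their actual Lebesgue measure.
\<close>

definition approximating_cone :: "(real ^ 'n) set \<Rightarrow> real ^ 'n \<Rightarrow> (real ^ 'n) set \<Rightarrow> bool"
  where "approximating_cone A p C \<longleftrightarrow>
    p \<in> frontier A \<and> open C \<and> cone_at p C \<and>
    (\<exists>R::real \<Rightarrow> real.
      (\<forall>t\<in>{0<..<1}. R t > 0) \<and>
      filterlim R at_top (at_right 0) \<and>
      ((\<lambda>t. sqrt t * R t) \<longlongrightarrow> 0) (at_right 0) \<and>
      ((\<lambda>t. t powr (- real CARD('n) / 2) *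
          measure lebesgue
            (sym_diff {w \<in> translate_to_origin p A. norm w \<le> sqrt t * R t}
                      {w \<in> translate_to_origin p C. norm w \<le> sqrt t * R t}))
        \<longlongrightarrow> 0) (at_right 0))"

definition kernel_integral :: "(real \<Rightarrow> real) \<Rightarrow> (real ^ 'n) set \<Rightarrow> real \<Rightarrow> real ^ 'n \<Rightarrow> real"
  where "kernel_integral \<kappa> A t x =
    (LINT y:A|lborel. t powr (- real CARD('n) / 2) * \<kappa> ((norm (x - y))\<^sup>2 / t))"

end

theory Submission imports Defs begin

text \<open>
  Everything is seen after the blow-up \<open>y = p + r z\<close>. Since \<open>r \<mapsto> g\<^sub>i (p + r z)\<close> has derivative
  \<open>\<nabla> g\<^sub>i(p) \<bullet> z\<close> at 0, for every \<open>z\<close> off the hyperplanes orthogonal to the gradients the point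
  \<open>p + r z\<close> lies in \<open>A\<close> for all small \<open>r > 0\<close> iff \<open>p + z\<close> lies in \<open>C\<close>. By dominated convergence,
  the integral of an integrable function over \<open>(A - p) / r\<close> tends to that over \<open>C - p\<close>.
  Applied to \<open>\<kappa>'(\<parallel>z\<parallel>\<^sup>2) z\<close> with \<open>r = \<surd>t\<close>, and after differentiating under the integral, this is the
  gradient formula. Applied to the unit ball, it says that the symmetric difference within distance
  \<open>r\<close> has relative volume \<open>\<phi>(r) \<rightarrow> 0\<close>, and any such \<open>\<phi>\<close> admits \<open>R \<rightarrow> \<infinity>\<close> growing so slowly that
  \<open>R(t)\<^sup>N \<phi>(\<surd>t R(t)) \<rightarrow> 0\<close>.
\<close>

section \<open>Affine substitution, and limits and derivatives of integrals\<close>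

lemma lborel_integral_affine:
  fixes f :: "'a::euclidean_space \<Rightarrow> 'b::{banach, second_countable_topology}"
  assumes [measurable]: "f \<in> borel_measurable borel" and c: "c \<noteq> 0"
  shows "integral\<^sup>L lborel f = \<bar>c\<bar> ^ DIM('a) *\<^sub>R (LINT x|lborel. f (a + c *\<^sub>R x))"
  by (subst lborel_affine[OF c, of a]) (simp add: integral_density integral_distr)

text \<open>Almost everywhere the two indicators agree for all small \<open>r\<close>, with a
  threshold that may depend on the point, and \<open>norm (f x)\<close> dominates. The filter is
  reduced to sequences because dominated convergence is used in its sequential form.\<close>

lemma tendsto_set_integral_AE_eventually:
  fixes f :: "'a \<Rightarrow> 'b::{banach, second_countable_topology}"
  assumes f: "integrable M f"
    and S[measurable]: "\<And>r. S r \<in> sets M" and T[measurable]: "T \<in> sets M"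
    and ev: "AE x in M. \<forall>\<^sub>F r in at_right (0::real). x \<in> S r \<longleftrightarrow> x \<in> T"
  shows "((\<lambda>r. LINT x:S r|M. f x) \<longlongrightarrow> (LINT x:T|M. f x)) (at_right 0)"
  unfolding tendsto_at_iff_sequentially
proof (intro allI impI)
  fix X :: "nat \<Rightarrow> real"
  assume X: "\<forall>i. X i \<in> {0<..} - {0}" and X0: "X \<longlonglongrightarrow> 0"
  have lim: "filterlim X (at_right 0) sequentially"
    using X X0 by (auto simp: filterlim_at order_less_le)
  have [measurable]: "f \<in> borel_measurable M"
    using f by simp
  show "((\<lambda>r. LINT x:S r|M. f x) \<circ> X) \<longlonglongrightarrow> (LINT x:T|M. f x)"
    unfolding set_lebesgue_integral_def comp_def
  proof (rule integral_dominated_convergence[where w = "\<lambda>x. norm (f x)"])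
    show "AE x in M. (\<lambda>i. indicat_real (S (X i)) x *\<^sub>R f x) \<longlonglongrightarrow> indicat_real T x *\<^sub>R f x"
      using ev
    proof eventually_elim
      case (elim x)
      then have "\<forall>\<^sub>F i in sequentially. x \<in> S (X i) \<longleftrightarrow> x \<in> T"
        using lim by (rule eventually_compose_filterlim)
      then show ?case
        by (intro tendsto_eventually) (auto elim!: eventually_mono simp: indicator_def)
    qed
  qed (use f in \<open>auto simp: indicator_def\<close>)
qed

text \<open>Dominated convergence applied to the remainder quotient in the definition of the Frechet
  derivative. In \<open>bound\<close> the quantifier over \<open>x\<close> stands inside the
  \<open>AE\<close>: a single null set has to serve the whole ball, since the mean value inequality
  is applied for fixed \<open>y\<close>.\<close>

lemma has_derivative_integral_dominated:
  fixes f :: "'a::real_normed_vector \<Rightarrow> 'b \<Rightarrow> 'c::{banach, second_countable_topology}"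
  assumes "r > 0"
    and f: "\<And>x. x \<in> ball a r \<Longrightarrow> integrable M (f x)"
    and f': "\<And>h. integrable M (\<lambda>y. f' a y h)"
    and deriv: "\<And>x y. x \<in> ball a r \<Longrightarrow> ((\<lambda>x. f x y) has_derivative f' x y) (at x)"
    and bound: "AE y in M. \<forall>x\<in>ball a r. onorm (f' x y) \<le> w y"
    and w: "integrable M w"
  shows "((\<lambda>x. LINT y|M. f x y) has_derivative (\<lambda>h. LINT y|M. f' a y h)) (at a)"
proof -
  have a: "a \<in> ball a r"
    using \<open>r > 0\<close> by simp
  have bl: "bounded_linear (f' x y)" if "x \<in> ball a r" for x y
    using deriv[OF that] by (rule has_derivative_bounded_linear)
  have bound': "AE y in M. \<forall>h. norm (f' a y h) \<le> w y * norm h"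
    using bound
  proof eventually_elim
    case (elim y)
    show ?case
      using onorm[OF bl[OF a]] elim a
      by (meson mult_right_mono norm_ge_zero order_trans)
  qed
  have diff_bound: "AE y in M. \<forall>x\<in>ball a r. norm (f x y - f a y) \<le> w y * norm (x - a)"
    using bound
  proof eventually_elim
    case (elim y)
    show ?case
    proof
      fix x assume "x \<in> ball a r"
      then show "norm (f x y - f a y) \<le> w y * norm (x - a)"
        using elim a
        by (intro differentiable_bound[OF convex_ball, where f' = "\<lambda>x. f' x y"])
          (auto intro!: has_derivative_at_withinI deriv)
    qed
  qed
  have lin: "bounded_linear (\<lambda>h. LINT y|M. f' a y h)"
  proof (rule bounded_linear_intro[where K = "integral\<^sup>L M w"])
    fix x y and c :: real
    show "(LINT z|M. f' a z (x + y)) = (LINT z|M. f' a z x) + (LINT z|M. f' a z y)"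
      using bl[OF a] f' by (simp add: bounded_linear.linear linear_add)
    show "(LINT z|M. f' a z (c *\<^sub>R x)) = c *\<^sub>R (LINT z|M. f' a z x)"
      using bl[OF a] f' by (simp add: bounded_linear.linear linear_scale)
    have "norm (LINT z|M. f' a z x) \<le> (LINT z|M. w z * norm x)"
      using bound' w f' by (intro order_trans[OF integral_norm_bound integral_mono_AE]) (auto elim: eventually_mono)
    then show "norm (LINT z|M. f' a z x) \<le> norm x * integral\<^sup>L M w"
      by (simp add: mult.commute)
  qed
  \<comment> \<open>The remainder quotient. At \<open>x = a\<close> it is 0, as inversion sends 0 to
    0, so the bound \<open>2 * w y\<close> (one \<open>w y\<close> from the increment of
    \<open>f\<close>, one from \<open>f' a\<close>) holds on the whole ball.\<close>
  define q where "q x y = ((f x y - f a y) - f' a y (x - a)) /\<^sub>R norm (x - a)" for x y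
  have q: "integrable M (\<lambda>y. q x y)" if "x \<in> ball a r" for x
    unfolding q_def
    by (intro integrable_scaleR_right Bochner_Integration.integrable_diff f f' a that)
  have q_bound: "AE y in M. \<forall>x\<in>ball a r. norm (q x y) \<le> 2 * w y"
    using bound' diff_bound bound
  proof eventually_elim
    case (elim y)
    show ?case
    proof
      fix x assume x: "x \<in> ball a r"
      have "norm ((f x y - f a y) - f' a y (x - a)) \<le> 2 * w y * norm (x - a)"
        using elim(1)[rule_format, of "x - a"] elim(2)[rule_format, OF x]
          norm_triangle_ineq4[of "f x y - f a y" "f' a y (x - a)"] by linarith
      then have "norm ((f x y - f a y) - f' a y (x - a)) / norm (x - a) \<le> 2 * w y" if "x \<noteq> a"
        using that by (simp add: pos_divide_le_eq)
      moreover have "0 \<le> w y"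
        using elim(3) a x onorm_pos_le[OF bl[OF a], of y] by (meson order_trans)
      ultimately show "norm (q x y) \<le> 2 * w y"
        unfolding q_def by (cases "x = a") (simp_all add: divide_inverse_commute)
    qed
  qed
  \<comment> \<open>The limit is first taken within the ball, so that every term of a test sequence
    obeys the bound; openness of the ball removes the restriction afterwards.\<close>
  have "((\<lambda>x. LINT y|M. q x y) \<longlongrightarrow> (LINT y|M. 0)) (at a within ball a r)"
    unfolding tendsto_at_iff_sequentially
  proof (intro allI impI)
    fix X :: "nat \<Rightarrow> 'a"
    assume X: "\<forall>i. X i \<in> ball a r - {a}" and Xa: "X \<longlonglongrightarrow> a"
    have Xlim: "filterlim X (at a) sequentially"
      using X Xa by (auto simp: filterlim_at)
    show "((\<lambda>x. LINT y|M. q x y) \<circ> X) \<longlonglongrightarrow> (LINT y|M. 0)"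
      unfolding comp_def
    proof (rule integral_dominated_convergence[where w = "\<lambda>y. 2 * w y"])
      show "AE y in M. (\<lambda>i. q (X i) y) \<longlonglongrightarrow> 0"
      proof (intro AE_I2)
        fix y
        have "((\<lambda>x. q x y) \<longlongrightarrow> 0) (at a)"
          using deriv[OF a, of y] unfolding q_def has_derivative_at_within by simp
        then show "(\<lambda>i. q (X i) y) \<longlonglongrightarrow> 0"
          using Xlim by (rule filterlim_compose)
      qed
      show "AE y in M. norm (q (X i) y) \<le> 2 * w y" for i
        using q_bound X by (auto elim: eventually_mono)
    qed (use q[THEN borel_measurable_integrable] X w in auto)
  qed
  then have "((\<lambda>x. LINT y|M. q x y) \<longlongrightarrow> 0) (at a)"
    using \<open>r > 0\<close> by (simp add: at_within_open[OF a])
  moreover have "\<forall>\<^sub>F x in at a. (LINT y|M. q x y) =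
      (((LINT y|M. f x y) - (LINT y|M. f a y)) - (LINT y|M. f' a y (x - a))) /\<^sub>R norm (x - a)"
    using eventually_at_ball[OF \<open>r > 0\<close>]
    by eventually_elim (use f f' a in \<open>simp add: q_def\<close>)
  ultimately show ?thesis
    unfolding has_derivative_at_within using lin
    by (blast intro: Lim_transform_eventually)
qed

section \<open>Choice of the slowly growing radius\<close>

lemma exists_slow_scale:
  fixes \<phi> :: "real \<Rightarrow> real"
  assumes nonneg: "\<And>s. s > 0 \<Longrightarrow> 0 \<le> \<phi> s" and bdd: "\<And>s. s > 0 \<Longrightarrow> \<phi> s \<le> B"
    and lim: "(\<phi> \<longlongrightarrow> 0) (at_right 0)" and n: "n \<ge> 1"
  shows "\<exists>R. (\<forall>t\<in>{0<..<1}. R t > 0) \<and> filterlim R at_top (at_right 0) \<and>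
    ((\<lambda>t. sqrt t * R t) \<longlongrightarrow> 0) (at_right 0) \<and>
    ((\<lambda>t. R t ^ n * \<phi> (sqrt t * R t)) \<longlongrightarrow> 0) (at_right 0)"
proof -
  \<comment> \<open>\<open>\<phi>\<close> need not be monotone and will be evaluated at a point
    known only to be at most \<open>s\<close>, so it is replaced by its running supremum, finite
    because of the bound \<open>B\<close>. The summand \<open>s\<close> makes \<open>\<psi>\<close>
    positive and keeps it from decaying faster than linearly.\<close>
  define \<psi> where "\<psi> s = s + (SUP u\<in>{0<..s}. \<phi> u)" for s :: real
  have bdd_above: "bdd_above (\<phi> ` {0<..s})" for s
    using bdd by (intro bdd_aboveI2[where M = B]) auto
  have \<phi>_le: "\<phi> u \<le> \<psi> s" if "0 < u" "u \<le> s" for u s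
    using cSUP_upper[OF _ bdd_above, of u s] that unfolding \<psi>_def by auto
  have \<psi>_ge: "s \<le> \<psi> s" if "0 < s" for s
    using cSUP_upper[OF _ bdd_above, of s s] nonneg[of s] that unfolding \<psi>_def by auto
  have \<psi>_pos: "0 < \<psi> s" if "0 < s" for s
    using \<psi>_ge[OF that] that by simp
  have \<psi>_lim: "(\<psi> \<longlongrightarrow> 0) (at_right 0)"
  proof -
    have "\<forall>\<^sub>F s in at_right 0. norm (\<psi> s) < \<epsilon>" if "\<epsilon> > 0" for \<epsilon>
    proof -
      have "\<forall>\<^sub>F s in at_right 0. norm (\<phi> s) < \<epsilon> / 2"
        using lim that by (auto simp: tendsto_iff dest!: spec[of _ "\<epsilon> / 2"])
      then obtain d where d: "d > 0" "\<And>s. 0 < s \<Longrightarrow> s < d \<Longrightarrow> \<bar>\<phi> s\<bar> < \<epsilon> / 2"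
        by (auto simp: eventually_at_right_field)
      \<comment> \<open>Half of \<epsilon> is spent on the summand \<open>s\<close>, half on the
        supremum.\<close>
      have "norm (\<psi> s) < \<epsilon>" if "0 < s" "s < min d (\<epsilon> / 2)" for s
      proof -
        have "\<phi> u \<le> \<epsilon> / 2" if "u \<in> {0<..s}" for u
          using d(2)[of u] that \<open>s < min d (\<epsilon> / 2)\<close> by simp
        then have "(SUP u\<in>{0<..s}. \<phi> u) \<le> \<epsilon> / 2"
          using that by (intro cSUP_least) auto
        then show ?thesis
          using that \<psi>_ge[of s] unfolding \<psi>_def by auto
      qed
      then show ?thesis
        using d(1) that by (auto simp: eventually_at_right_field intro!: exI[of _ "min d (\<epsilon> / 2)"])
    qed
    then show ?thesis
      by (simp add: tendsto_iff)
  qed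
  \<comment> \<open>\<open>R = 1 / Q\<close> works: \<open>\<psi>\<close> dominates \<open>\<phi>\<close> on \<open>{0<..s}\<close>, and \<open>\<psi> s \<ge> s\<close> keeps \<open>\<surd>t R(t) \<le> s = t\<^sup>1\<^sup>/\<^sup>4\<close>.\<close>
  define Q where "Q t = root (2 * n) (\<psi> (sqrt (sqrt t)))" for t
  have "filterlim (\<lambda>t. sqrt (sqrt t)) (at_right 0) (at_right 0)"
    unfolding filterlim_at
    by (auto simp: eventually_at_right_field intro!: tendsto_eq_intros exI[of _ 1])
  then have "((\<lambda>t. \<psi> (sqrt (sqrt t))) \<longlongrightarrow> 0) (at_right 0)"
    using \<psi>_lim by (rule filterlim_compose[rotated])
  from tendsto_real_root[OF this, of "2 * n"] have Q_lim: "(Q \<longlongrightarrow> 0) (at_right 0)"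
    unfolding Q_def by simp
  have Q_pos: "0 < Q t" if "0 < t" for t
    using \<psi>_pos[of "sqrt (sqrt t)"] that n unfolding Q_def by simp
  have Q_pow: "Q t ^ (2 * n) = \<psi> (sqrt (sqrt t))" if "0 < t" for t
    using \<psi>_pos[of "sqrt (sqrt t)"] that n unfolding Q_def by (simp add: real_root_pow_pos)
  \<comment> \<open>With \<open>s\<close> the fourth root of \<open>t\<close>, \<open>t < 1\<close>
    gives \<open>s ^ (2 * n) \<le> s \<le> \<psi> s = Q t ^ (2 * n)\<close>, hence
    \<open>s \<le> Q t\<close>, and \<open>sqrt t = s * s\<close> yields the bound.\<close>
  have scale: "sqrt t * inverse (Q t) \<le> sqrt (sqrt t)" if "t \<in> {0<..<1}" for t
  proof -
    let ?s = "sqrt (sqrt t)"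
    have s: "0 < ?s" "?s \<le> 1"
      using that by auto
    have "?s ^ (2 * n) \<le> ?s ^ 1"
      using s n by (intro power_decreasing) auto
    also have "\<dots> \<le> Q t ^ (2 * n)"
      using \<psi>_ge[OF s(1)] Q_pow that by simp
    finally have "?s \<le> Q t"
      using power_mono_iff[of ?s "Q t" "2 * n"] s Q_pos[of t] n that by simp
    then have "?s * ?s \<le> ?s * Q t"
      using s by (intro mult_left_mono) auto
    moreover have "?s * ?s = sqrt t"
      using that by simp
    ultimately have "sqrt t \<le> ?s * Q t"
      by (simp only:)
    then have "sqrt t / Q t \<le> ?s"
      using Q_pos[of t] that by (simp only: pos_divide_le_eq greaterThanLessThan_iff)
    then show ?thesis
      by (simp only: divide_inverse)
  qed
  show ?thesis
  proof (intro exI[of _ "\<lambda>t. inverse (Q t)"] conjI)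
    show "\<forall>t\<in>{0<..<1}. inverse (Q t) > 0"
      using Q_pos by simp
    show "filterlim (\<lambda>t. inverse (Q t)) at_top (at_right 0)"
      using Q_lim Q_pos Q_pos[THEN less_imp_neq, THEN not_sym]
      by (intro filterlim_compose[OF filterlim_inverse_at_top_right])
        (auto simp: filterlim_at eventually_at_right_field intro!: exI[of _ 1])
    have ev: "\<forall>\<^sub>F t in at_right 0. t \<in> {0<..<1::real}"
      by (rule eventually_at_right_real) simp
    show "((\<lambda>t. sqrt t * inverse (Q t)) \<longlongrightarrow> 0) (at_right 0)"
    proof (rule tendsto_sandwich)
      show "\<forall>\<^sub>F t in at_right 0. 0 \<le> sqrt t * inverse (Q t)"
        using ev by eventually_elim (simp add: less_imp_le[OF Q_pos])
      show "\<forall>\<^sub>F t in at_right 0. sqrt t * inverse (Q t) \<le> sqrt (sqrt t)"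
        using ev by eventually_elim (rule scale)
      show "((\<lambda>t. sqrt (sqrt t)) \<longlongrightarrow> 0) (at_right 0)"
        by (auto intro!: tendsto_eq_intros)
    qed auto
    show "((\<lambda>t. inverse (Q t) ^ n * \<phi> (sqrt t * inverse (Q t))) \<longlongrightarrow> 0) (at_right 0)"
    proof (rule tendsto_sandwich)
      show "\<forall>\<^sub>F t in at_right 0. 0 \<le> inverse (Q t) ^ n * \<phi> (sqrt t * inverse (Q t))"
        using ev by eventually_elim (simp add: Q_pos nonneg less_imp_le[OF Q_pos])
      show "\<forall>\<^sub>F t in at_right 0. inverse (Q t) ^ n * \<phi> (sqrt t * inverse (Q t)) \<le> Q t ^ n"
        using ev
      proof eventually_elim
        case (elim t)
        then have "0 < t" by simp
        \<comment> \<open>Here the root of order \<open>2 * n\<close> pays off: half of the power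
          \<open>Q t ^ (2 * n)\<close> absorbs \<open>inverse (Q t) ^ n\<close>, and the other half
          still tends to 0.\<close>
        have "\<phi> (sqrt t * inverse (Q t)) \<le> Q t ^ (2 * n)"
          unfolding Q_pow[OF \<open>0 < t\<close>]
          using \<phi>_le[OF _ scale[OF elim]] Q_pos[OF \<open>0 < t\<close>] \<open>0 < t\<close> by simp
        then have "inverse (Q t) ^ n * \<phi> (sqrt t * inverse (Q t)) \<le> inverse (Q t) ^ n * Q t ^ (2 * n)"
          using Q_pos[OF \<open>0 < t\<close>] by (intro mult_left_mono) auto
        also have "\<dots> = Q t ^ n"
          using Q_pos[OF \<open>0 < t\<close>] by (simp add: mult_2 power_add power_inverse)
        finally show ?case .
      qed
      show "((\<lambda>t. Q t ^ n) \<longlongrightarrow> 0) (at_right 0)"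
        using n by (auto intro!: tendsto_eq_intros Q_lim)
    qed auto
  qed
qed

section \<open>Radial kernels and differentiation under the integral\<close>

text \<open>Turns the extended-valued supremum in (\<kappa>2) into a real dominating function. Where
  the supremum is infinite \<open>enn2real\<close> returns 0, so the majorization can be claimed
  only almost everywhere.\<close>

lemma integrable_majorant_of_SUP:
  fixes q :: "'b \<Rightarrow> 'a::euclidean_space \<Rightarrow> real"
  assumes cont: "\<And>b. b \<in> K \<Longrightarrow> continuous_on UNIV (q b)"
    and fin: "(\<integral>\<^sup>+x. (SUP b\<in>K. ennreal (q b x)) \<partial>lborel) < \<infinity>"
  obtains w where "integrable lborel w" "AE x in lborel. \<forall>b\<in>K. q b x \<le> w x"
proof
  let ?S = "\<lambda>x. SUP b\<in>K. ennreal (q b x)"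
  \<comment> \<open>A supremum of continuous functions, even an uncountable one, is lower semicontinuous.\<close>
  have [measurable]: "?S \<in> borel_measurable lborel"
  proof (rule borel_measurableI_greater)
    fix y
    have "open {x. y < ennreal (q b x)}" if "b \<in> K" for b
      using cont[OF that] by (intro open_Collect_less continuous_on_ennreal) auto
    moreover have "{x \<in> space lborel. y < ?S x} = (\<Union>b\<in>K. {x. y < ennreal (q b x)})"
      by (auto simp: less_SUP_iff)
    ultimately show "{x \<in> space lborel. y < ?S x} \<in> sets lborel"
      by (simp add: open_UN borel_open)
  qed
  have finite: "AE x in lborel. ?S x \<noteq> \<infinity>"
    using fin by (intro nn_integral_PInf_AE) auto
  then have "(\<integral>\<^sup>+x. ennreal (enn2real (?S x)) \<partial>lborel) = (\<integral>\<^sup>+x. ?S x \<partial>lborel)"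
    by (intro nn_integral_cong_AE, eventually_elim)
      (simp only: ennreal_enn2real less_top infinity_ennreal_def)
  then show "integrable lborel (\<lambda>x. enn2real (?S x))"
    using fin by (intro integrableI_nonneg) auto
  show "AE x in lborel. \<forall>b\<in>K. q b x \<le> enn2real (?S x)"
    using finite
  proof eventually_elim
    case (elim x)
    show ?case
    proof
      fix b assume "b \<in> K"
      then have "ennreal (q b x) \<le> ?S x"
        by (rule SUP_upper)
      also have "\<dots> = ennreal (enn2real (?S x))"
        using elim by (simp only: ennreal_enn2real less_top infinity_ennreal_def)
      finally show "q b x \<le> enn2real (?S x)"
        by (simp add: ennreal_le_iff)
    qed
  qed
qed

text \<open>Evenness takes the place of a reflection of the measure, so that translation invariance
  suffices.\<close>

lemma integrable_lborel_reflect_translate: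
  fixes f :: "'a::euclidean_space \<Rightarrow> real"
  assumes f: "integrable lborel f" and even: "\<And>x. f (- x) = f x"
  shows "integrable lborel (\<lambda>z. f (b - z))"
proof -
  have [measurable]: "f \<in> borel_measurable borel"
    using f by simp
  have "integrable (distr lborel borel ((+) (- b))) f"
    using f by (simp add: lborel_distr_plus)
  then have "integrable lborel (\<lambda>z. f (- b + z))"
    by (subst (asm) integrable_distr_eq) auto
  moreover have "f (- b + z) = f (b - z)" for z
    using even[of "b - z"] by simp
  ultimately show ?thesis
    by simp
qed

text \<open>At \<open>b = z\<close> the outer function has only a one-sided derivative. The chain
  rule is therefore used relative to the range of the squared norm, which lies in
  \<open>{0..}\<close>.\<close>

lemma has_derivative_radial:
  fixes z :: "'a::real_inner"
  assumes "\<And>r. r \<ge> 0 \<Longrightarrow> (\<kappa> has_real_derivative \<kappa>' r) (at r within {0..})"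
  shows "((\<lambda>b. \<kappa> ((norm (b - z))\<^sup>2)) has_derivative
    (\<lambda>h. 2 * \<kappa>' ((norm (b - z))\<^sup>2) * ((b - z) \<bullet> h))) (at b)"
proof -
  have "((\<lambda>b. (norm (b - z))\<^sup>2) has_derivative (\<lambda>h. 2 * ((b - z) \<bullet> h))) (at b)"
    unfolding power2_norm_eq_inner
    by (auto intro!: derivative_eq_intros simp: inner_commute)
  moreover have "(\<kappa> has_derivative (*) (\<kappa>' ((norm (b - z))\<^sup>2)))
      (at ((norm (b - z))\<^sup>2) within range (\<lambda>b. (norm (b - z))\<^sup>2))"
    using assms[of "(norm (b - z))\<^sup>2"] unfolding has_field_derivative_def
    by (rule has_derivative_subset) auto
  ultimately have "((\<lambda>b. \<kappa> ((norm (b - z))\<^sup>2)) has_derivative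
      (\<lambda>h. \<kappa>' ((norm (b - z))\<^sup>2) * (2 * ((b - z) \<bullet> h)))) (at b)"
    by (rule has_derivative_in_compose)
  then show ?thesis
    by (simp only: ac_simps)
qed

lemma continuous_on_radial:
  fixes f :: "real \<Rightarrow> real"
  assumes "continuous_on {0..} f"
  shows "continuous_on S (\<lambda>z. f ((norm (z + b))\<^sup>2))"
  by (rule continuous_on_compose2[OF assms]) (auto intro!: continuous_intros)

text \<open>This is the case \<open>K = {0}\<close> of the supremum condition.\<close>

lemma integrable_radial_gradient:
  fixes \<kappa>' :: "real \<Rightarrow> real"
  assumes cont: "continuous_on {0..} \<kappa>'"
    and \<kappa>2: "\<And>K :: 'a::euclidean_space set. compact K \<Longrightarrow>
      (\<integral>\<^sup>+x. (SUP b\<in>K. ennreal (norm (x + b) * \<bar>\<kappa>' ((norm (x + b))\<^sup>2)\<bar>)) \<partial>lborel) < \<infinity>"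
  shows "integrable lborel (\<lambda>z :: 'a. \<kappa>' ((norm z)\<^sup>2) *\<^sub>R z)"
proof (rule integrableI_bounded)
  show "(\<lambda>z :: 'a. \<kappa>' ((norm z)\<^sup>2) *\<^sub>R z) \<in> borel_measurable lborel"
    using continuous_on_radial[OF cont, of UNIV "0::'a"]
    by (auto intro!: borel_measurable_continuous_onI continuous_intros)
  show "(\<integral>\<^sup>+z. ennreal (norm (\<kappa>' ((norm z)\<^sup>2) *\<^sub>R (z :: 'a))) \<partial>lborel) < \<infinity>"
    using \<kappa>2[of "{0}"] by (simp add: mult.commute)
qed

text \<open>Condition (\<kappa>2) for the closed unit ball provides one dominating function for all
  \<open>b\<close> near 0; only the derivative at 0 is required, since the blow-up moves
  \<open>p\<close> there.\<close>

lemma has_derivative_radial_integral: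
  fixes S :: "'a::euclidean_space set"
  assumes S[measurable]: "S \<in> sets borel"
    and deriv: "\<And>r. r \<ge> 0 \<Longrightarrow> (\<kappa> has_real_derivative \<kappa>' r) (at r within {0..})"
    and cont: "continuous_on {0..} \<kappa>'"
    and \<kappa>1: "(\<integral>\<^sup>+x. ennreal \<bar>\<kappa> ((norm (x :: 'a))\<^sup>2)\<bar> \<partial>lborel) < \<infinity>"
    and \<kappa>2: "\<And>K :: 'a set. compact K \<Longrightarrow>
      (\<integral>\<^sup>+x. (SUP b\<in>K. ennreal (norm (x + b) * \<bar>\<kappa>' ((norm (x + b))\<^sup>2)\<bar>)) \<partial>lborel) < \<infinity>"
  shows "((\<lambda>b. LINT z:S|lborel. \<kappa> ((norm (b - z))\<^sup>2)) has_derivative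
    (\<lambda>h. h \<bullet> (- 2 *\<^sub>R (LINT z:S|lborel. \<kappa>' ((norm z)\<^sup>2) *\<^sub>R z)))) (at 0)"
proof -
  define f where "f b z = indicat_real S z *\<^sub>R \<kappa> ((norm (b - z))\<^sup>2)" for b z
  define f' where "f' b z h = indicat_real S z *\<^sub>R (2 * \<kappa>' ((norm (b - z))\<^sup>2) * ((b - z) \<bullet> h))" for b z h
  define G where "G z = indicat_real S z *\<^sub>R \<kappa>' ((norm z)\<^sup>2) *\<^sub>R z" for z
  have "continuous_on {0..} \<kappa>"
    using deriv by (rule DERIV_continuous_on) auto
  from continuous_on_radial[OF this, of UNIV "0::'a"]
  have "integrable lborel (\<lambda>z :: 'a. \<kappa> ((norm z)\<^sup>2))"
    using \<kappa>1 by (intro integrableI_bounded) (auto intro!: borel_measurable_continuous_onI)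
  then have f_int: "integrable lborel (f b)" for b
    unfolding f_def[abs_def]
    by (intro integrable_mult_indicator integrable_lborel_reflect_translate) auto
  have G_int: "integrable lborel G"
    unfolding G_def[abs_def]
    by (intro integrable_mult_indicator integrable_radial_gradient[OF cont \<kappa>2]) auto
  \<comment> \<open>At \<open>b = 0\<close> the factor \<open>b - z\<close> is \<open>- z\<close>,
    which is the source of the minus sign in the gradient formula.\<close>
  have f'_eq: "f' 0 z h = h \<bullet> (- 2 *\<^sub>R G z)" for z h
    unfolding f'_def G_def by (simp add: inner_commute)
  define q where "q b z = norm (z + b) * \<bar>\<kappa>' ((norm (z + b))\<^sup>2)\<bar>" for b z :: 'a
  obtain w where w: "integrable lborel w" "AE z in lborel. \<forall>b\<in>cball 0 1. q b z \<le> w z"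
  proof (rule integrable_majorant_of_SUP[of "cball 0 1" q])
    show "continuous_on UNIV (q b)" for b
      unfolding q_def[abs_def] by (intro continuous_intros continuous_on_radial cont)
    show "(\<integral>\<^sup>+x. (SUP b\<in>cball 0 1. ennreal (q b x)) \<partial>lborel) < \<infinity>"
      unfolding q_def by (rule \<kappa>2) simp
  qed
  have "((\<lambda>b. LINT z|lborel. f b z) has_derivative (\<lambda>h. LINT z|lborel. f' 0 z h)) (at 0)"
  proof (rule has_derivative_integral_dominated[where r = 1 and w = "\<lambda>z. 2 * w z"])
    show "integrable lborel (\<lambda>z. f' 0 z h)" for h
      unfolding f'_eq using G_int by (intro integrable_inner_right integrable_scaleR_right)
    show "((\<lambda>b. f b z) has_derivative f' b z) (at b)" for b z
      unfolding f_def f'_def[abs_def]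
      by (intro has_derivative_scaleR_right has_derivative_radial deriv)
    show "AE z in lborel. \<forall>b\<in>ball 0 1. onorm (f' b z) \<le> 2 * w z"
      using w(2)
    proof eventually_elim
      case (elim z)
      show ?case
      proof
        fix b :: 'a assume "b \<in> ball 0 1"
        \<comment> \<open>The supremum condition involves \<open>z + b\<close> and the kernel
          \<open>b - z\<close>; the unit ball is symmetric, so \<open>- b\<close> is an admissible
          parameter.\<close>
        then have "q (- b) z \<le> w z"
          using elim by simp
        then have qw: "norm (b - z) * \<bar>\<kappa>' ((norm (b - z))\<^sup>2)\<bar> \<le> w z"
          by (simp add: q_def norm_minus_commute)
        have "norm (f' b z h) \<le> 2 * (norm (b - z) * \<bar>\<kappa>' ((norm (b - z))\<^sup>2)\<bar>) * norm h" for h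
        proof -
          have "norm (f' b z h) \<le> 2 * \<bar>\<kappa>' ((norm (b - z))\<^sup>2)\<bar> * \<bar>(b - z) \<bullet> h\<bar>"
            by (simp add: f'_def indicator_def abs_mult)
          also have "\<dots> \<le> 2 * \<bar>\<kappa>' ((norm (b - z))\<^sup>2)\<bar> * (norm (b - z) * norm h)"
            by (intro mult_left_mono Cauchy_Schwarz_ineq2) auto
          finally show ?thesis
            by (simp add: ac_simps)
        qed
        then have "onorm (f' b z) \<le> 2 * (norm (b - z) * \<bar>\<kappa>' ((norm (b - z))\<^sup>2)\<bar>)"
          by (intro onorm_bound) auto
        then show "onorm (f' b z) \<le> 2 * w z"
          using qw by linarith
      qed
    qed
  qed (use f_int w(1) in auto)
  moreover have "(LINT z|lborel. f' 0 z h) = h \<bullet> (- 2 *\<^sub>R (LINT z|lborel. G z))" for h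
    unfolding f'_eq using G_int
    by (subst integral_inner_right) auto
  ultimately show ?thesis
    unfolding set_lebesgue_integral_def f_def G_def by simp
qed

section \<open>Rescaling of the kernel integral\<close>

text \<open>Under \<open>y = p + sqrt t *\<^sub>R z\<close> the Jacobian cancels the prefactor of
  the kernel. What remains of \<open>t\<close> is the domain \<open>(A - p) / sqrt t\<close> and the
  rescaled base point \<open>(x - p) / sqrt t\<close>.\<close>

lemma kernel_integral_blow_up:
  fixes A :: "(real ^ 'n) set"
  assumes [measurable]: "A \<in> sets borel" and "t > 0" and cont: "continuous_on {0..} \<kappa>"
  shows "kernel_integral \<kappa> A t x =
    (LINT z:{z. p + sqrt t *\<^sub>R z \<in> A}|lborel. \<kappa> ((norm ((x - p) /\<^sub>R sqrt t - z))\<^sup>2))"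
proof -
  have [measurable]: "(\<lambda>y. \<kappa> ((norm (x - y))\<^sup>2 / t)) \<in> borel_measurable borel"
    using \<open>t > 0\<close>
    by (intro borel_measurable_continuous_onI continuous_on_compose2[OF cont])
      (auto intro!: continuous_intros)
  have "x - (p + sqrt t *\<^sub>R z) = sqrt t *\<^sub>R ((x - p) /\<^sub>R sqrt t - z)" for z
    using \<open>t > 0\<close> by (simp add: scaleR_diff_right)
  then have arg: "(norm (x - (p + sqrt t *\<^sub>R z)))\<^sup>2 / t = (norm ((x - p) /\<^sub>R sqrt t - z))\<^sup>2" for z
    using \<open>t > 0\<close> by (simp only: norm_scaleR power_mult_distrib) simp
  have const: "\<bar>sqrt t\<bar> ^ CARD('n) * t powr (- real CARD('n) / 2) = 1"
    using \<open>t > 0\<close>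
    by (simp add: powr_half_sqrt[symmetric] powr_realpow[symmetric] powr_powr powr_add[symmetric])
  have "kernel_integral \<kappa> A t x = \<bar>sqrt t\<bar> ^ DIM(real ^ 'n) *\<^sub>R
      (LINT z|lborel. indicat_real A (p + sqrt t *\<^sub>R z) *\<^sub>R
        (t powr (- real CARD('n) / 2) * \<kappa> ((norm (x - (p + sqrt t *\<^sub>R z)))\<^sup>2 / t)))"
    unfolding kernel_integral_def set_lebesgue_integral_def
    using \<open>t > 0\<close> by (intro lborel_integral_affine) auto
  also have "\<dots> = (\<bar>sqrt t\<bar> ^ CARD('n) * t powr (- real CARD('n) / 2)) *
      (LINT z|lborel. indicat_real A (p + sqrt t *\<^sub>R z) * \<kappa> ((norm ((x - p) /\<^sub>R sqrt t - z))\<^sup>2))"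
    unfolding arg by (simp add: mult.left_commute[of _ "t powr _"])
  finally show ?thesis
    unfolding const by (simp add: set_lebesgue_integral_def indicator_def)
qed

lemma sets_borel_affine_preimage:
  fixes A :: "'a::euclidean_space set"
  assumes "A \<in> sets borel"
  shows "{z. p + r *\<^sub>R z \<in> A} \<in> sets borel"
proof -
  have "(\<lambda>z. p + r *\<^sub>R z) -` A \<in> sets borel"
    using assms by (rule measurable_sets_borel[rotated]) simp
  then show ?thesis
    by (simp add: vimage_def)
qed

text \<open>Chain rule through \<open>x \<mapsto> (x - p) / sqrt t\<close>, which sends
  \<open>p\<close> to 0 and contributes the factor \<open>1 / sqrt t\<close>. The formula is exact
  for each fixed \<open>t\<close>; asymptotics enter only through the domain of integration.\<close>

lemma gderiv_kernel_integral:
  fixes A :: "(real ^ 'n) set"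
  assumes A: "A \<in> sets borel" and t: "t > 0"
    and deriv: "\<And>r. r \<ge> 0 \<Longrightarrow> (\<kappa> has_real_derivative \<kappa>' r) (at r within {0..})"
    and cont: "continuous_on {0..} \<kappa>'"
    and \<kappa>1: "(\<integral>\<^sup>+x. ennreal \<bar>\<kappa> ((norm (x :: real ^ 'n))\<^sup>2)\<bar> \<partial>lborel) < \<infinity>"
    and \<kappa>2: "\<And>K :: (real ^ 'n) set. compact K \<Longrightarrow>
      (\<integral>\<^sup>+x. (SUP b\<in>K. ennreal (norm (x + b) * \<bar>\<kappa>' ((norm (x + b))\<^sup>2)\<bar>)) \<partial>lborel) < \<infinity>"
  shows "GDERIV (kernel_integral \<kappa> A t) p :>
    (- 2 / sqrt t) *\<^sub>R (LINT z:{z. p + sqrt t *\<^sub>R z \<in> A}|lborel. \<kappa>' ((norm z)\<^sup>2) *\<^sub>R z)"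
proof -
  let ?S = "{z. p + sqrt t *\<^sub>R z \<in> A}"
  let ?V = "LINT z:?S|lborel. \<kappa>' ((norm z)\<^sup>2) *\<^sub>R z"
  have S: "?S \<in> sets borel"
    using A by (rule sets_borel_affine_preimage)
  have "continuous_on {0..} \<kappa>"
    using deriv by (rule DERIV_continuous_on) auto
  then have eq: "kernel_integral \<kappa> A t =
      (\<lambda>x. LINT z:?S|lborel. \<kappa> ((norm ((x - p) /\<^sub>R sqrt t - z))\<^sup>2))"
    using kernel_integral_blow_up[OF A t] by blast
  have "((\<lambda>x. (x - p) /\<^sub>R sqrt t) has_derivative (\<lambda>h. h /\<^sub>R sqrt t)) (at p)"
    by (auto intro!: derivative_eq_intros)
  moreover have "((\<lambda>b. LINT z:?S|lborel. \<kappa> ((norm (b - z))\<^sup>2)) has_derivative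
      (\<lambda>h. h \<bullet> (- 2 *\<^sub>R ?V))) (at ((p - p) /\<^sub>R sqrt t))"
    using has_derivative_radial_integral[OF S deriv cont \<kappa>1 \<kappa>2] by simp
  ultimately have "((\<lambda>x. LINT z:?S|lborel. \<kappa> ((norm ((x - p) /\<^sub>R sqrt t - z))\<^sup>2)) has_derivative
      (\<lambda>h. (h /\<^sub>R sqrt t) \<bullet> (- 2 *\<^sub>R ?V))) (at p)"
    by (rule has_derivative_compose)
  moreover have "(h /\<^sub>R sqrt t) \<bullet> (- 2 *\<^sub>R ?V) = h \<bullet> ((- 2 / sqrt t) *\<^sub>R ?V)" for h
    by (simp add: divide_inverse)
  ultimately show ?thesis
    unfolding eq gderiv_def by simp
qed

section \<open>Blow-up of a corner\<close>

lemma translate_to_origin_eq: "translate_to_origin p S = {z. p + z \<in> S}"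
  unfolding translate_to_origin_def by (auto simp: image_iff intro!: bexI[of _ "p + _"])

lemma gderiv_pos_eventually:
  assumes "GDERIV f p :> D" "f p = 0" "D \<bullet> z > 0"
  shows "\<forall>\<^sub>F r in at_right 0. f (p + r *\<^sub>R z) > 0"
proof -
  have "((\<lambda>r. p + r *\<^sub>R z) has_derivative (\<lambda>h. h *\<^sub>R z)) (at 0)"
    by (auto intro!: derivative_eq_intros)
  from has_derivative_compose[OF this, of f "\<lambda>h. h \<bullet> D"] assms(1)
  have "((\<lambda>r. f (p + r *\<^sub>R z)) has_real_derivative (D \<bullet> z)) (at 0)"
    by (simp add: gderiv_def has_field_derivative_def inner_commute mult.commute[of _ "D \<bullet> z"])
  from DERIV_pos_inc_right[OF this assms(3)] show ?thesis
    using assms(2) by (auto simp: eventually_at_right_field)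
qed

text \<open>The linear term decides the sign along the ray unless it vanishes; a negative slope is
  the positive case for \<open>- f\<close>.\<close>

lemma gderiv_sign_eventually:
  assumes "GDERIV f p :> D" "f p = 0" "D \<bullet> z \<noteq> 0"
  shows "\<forall>\<^sub>F r in at_right 0. f (p + r *\<^sub>R z) > 0 \<longleftrightarrow> D \<bullet> z > 0"
proof (cases "D \<bullet> z > 0")
  case True
  then show ?thesis
    using gderiv_pos_eventually[OF assms(1,2)] by (auto elim: eventually_mono)
next
  case False
  have "GDERIV (\<lambda>x. - f x) p :> - D"
    using assms(1) by (rule GDERIV_minus)
  from gderiv_pos_eventually[OF this, of z] assms(2,3) False
  show ?thesis
    by (auto elim!: eventually_mono)
qed

lemma AE_lborel_not_orthogonal:
  fixes a :: "'a::euclidean_space"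
  assumes "a \<noteq> 0"
  shows "AE z in lborel. a \<bullet> z \<noteq> 0"
proof -
  have "{z. a \<bullet> z = 0} \<in> sets lborel"
    by (simp add: closed_hyperplane borel_closed)
  moreover have "{z. a \<bullet> z = 0} \<in> null_sets lebesgue"
    using assms negligible_hyperplane[of a 0] by (simp add: negligible_iff_null_sets)
  ultimately have "{z. a \<bullet> z = 0} \<in> null_sets lborel"
    by (simp add: null_sets_completion_iff)
  from AE_not_in[OF this] show ?thesis
    by simp
qed

text \<open>Off finitely many hyperplanes the signs of all \<open>g i (p + r *\<^sub>R z)\<close>
  settle to those of their linear parts, and membership in \<open>A\<close> near \<open>p\<close>
  and in \<open>C\<close> is the same Boolean combination of these signs. Finiteness of the index
  set gives a common threshold for \<open>r\<close>, depending on \<open>z\<close>.\<close>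

lemma corner_blow_up_AE:
  fixes A :: "'a::euclidean_space set"
  assumes corner: "corner_data \<alpha> A p U g k I m"
    and C: "C = (\<Union>j\<in>{1..m}. {x. \<forall>i\<in>I j. grad (g i) p \<bullet> (x - p) > 0})"
  shows "AE z in lborel. \<forall>\<^sub>F r in at_right 0. p + r *\<^sub>R z \<in> A \<longleftrightarrow> p + z \<in> C"
proof -
  have U: "open U" "p \<in> U"
    and A: "A \<inter> U = (\<Union>j\<in>{1..m}. {x\<in>U. \<forall>i\<in>I j. g i x > 0})"
    and I: "(\<Union>j\<in>{1..m}. I j) = {1..k}"
    and g0: "\<And>i. i \<in> {1..k} \<Longrightarrow> g i p = 0"
    using corner unfolding corner_data_def by auto
  have gderiv: "GDERIV (g i) p :> grad (g i) p" if "i \<in> {1..k}" for i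
  proof -
    have "C1_holder_on U \<alpha> (g i)"
      using corner that unfolding corner_data_def by (elim conjE) simp
    then obtain D where "GDERIV (g i) p :> D"
      using U(2) unfolding C1_holder_on_def by (elim conjE) blast
    then show ?thesis
      using grad_eqI by metis
  qed
  \<comment> \<open>Condition (C1) excludes zero gradients, so each orthogonal hyperplane is a null
    set.\<close>
  have nonzero: "grad (g i) p \<noteq> 0" if "i \<in> {1..k}" for i
  proof -
    obtain l where "\<forall>i\<in>{1..k}. grad (g i) p \<bullet> l > 0"
      using corner unfolding corner_data_def by (elim conjE exE) (rule that)
    then have "grad (g i) p \<bullet> l > 0"
      using \<open>i \<in> {1..k}\<close> by (rule bspec)
    then show ?thesis
      by auto
  qed
  have "AE z in lborel. \<forall>i\<in>{1..k}. grad (g i) p \<bullet> z \<noteq> 0"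
    by (intro AE_finite_allI AE_lborel_not_orthogonal nonzero) auto
  then show ?thesis
  proof eventually_elim
    case (elim z)
    have "((\<lambda>r. p + r *\<^sub>R z) \<longlongrightarrow> p) (at_right 0)"
      by (auto intro!: tendsto_eq_intros)
    from topological_tendstoD[OF this U]
    have "\<forall>\<^sub>F r in at_right 0. p + r *\<^sub>R z \<in> U" .
    moreover have "\<forall>\<^sub>F r in at_right 0. \<forall>i\<in>{1..k}. g i (p + r *\<^sub>R z) > 0 \<longleftrightarrow> grad (g i) p \<bullet> z > 0"
      using elim by (intro eventually_ball_finite ballI gderiv_sign_eventually gderiv g0) auto
    ultimately show ?case
    proof eventually_elim
      case (elim r)
      have "p + r *\<^sub>R z \<in> A \<longleftrightarrow> (\<exists>j\<in>{1..m}. \<forall>i\<in>I j. g i (p + r *\<^sub>R z) > 0)"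
        using A elim(1) by blast
      also have "\<dots> \<longleftrightarrow> (\<exists>j\<in>{1..m}. \<forall>i\<in>I j. grad (g i) p \<bullet> z > 0)"
        using elim(2) I by blast
      also have "\<dots> \<longleftrightarrow> p + z \<in> C"
        unfolding C by simp
      finally show ?case .
    qed
  qed
qed

text \<open>Openness uses that each block is finite; the defining inequalities are homogeneous in
  \<open>x - p\<close>, hence stable under positive scaling.\<close>

lemma corner_cone:
  assumes corner: "corner_data \<alpha> A p U g k I m"
    and C: "C = (\<Union>j\<in>{1..m}. {x. \<forall>i\<in>I j. grad (g i) p \<bullet> (x - p) > 0})"
  shows "open C" "cone_at p C"
proof -
  have "finite (I j)" if "j \<in> {1..m}" for j
    using corner that unfolding corner_data_def by (metis UN_upper finite_atLeastAtMost finite_subset)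
  then have "open (\<Inter>i\<in>I j. {x. grad (g i) p \<bullet> (x - p) > 0})" if "j \<in> {1..m}" for j
    using that by (intro open_INT ballI open_Collect_less continuous_intros) auto
  moreover have "C = (\<Union>j\<in>{1..m}. \<Inter>i\<in>I j. {x. grad (g i) p \<bullet> (x - p) > 0})"
    unfolding C by auto
  ultimately show "open C"
    by auto
  show "cone_at p C"
    unfolding cone_at_def translate_to_origin_eq C by fastforce
qed

section \<open>From the blow-up limit to the approximating cone\<close>

lemma approximating_cone_of_blow_up:
  fixes A :: "(real ^ 'n) set"
  assumes p: "p \<in> frontier A" and A: "open A" and C: "open C" and cone: "cone_at p C"
    and ev: "AE z in lborel. \<forall>\<^sub>F r in at_right 0. p + r *\<^sub>R z \<in> A \<longleftrightarrow> p + z \<in> C"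
  shows "approximating_cone A p C"
proof -
  have borel: "A \<in> sets borel" "C \<in> sets borel"
    using A C by auto
  define D where "D r = {z. (p + r *\<^sub>R z \<in> A) \<noteq> (p + z \<in> C)}" for r
  have D: "D r \<in> sets lborel" for r
  proof -
    have "D r = sym_diff {z. p + r *\<^sub>R z \<in> A} {z. p + 1 *\<^sub>R z \<in> C}"
      unfolding D_def by auto
    then show ?thesis
      by (simp only: sets_lborel sets.Un sets.Diff sets_borel_affine_preimage borel)
  qed
  \<comment> \<open>The volume of the mismatch \<open>D r\<close> inside the unit ball. It is
    bounded by the volume of that ball, and tends to 0 because almost every point leaves
    \<open>D r\<close> for small \<open>r\<close>.\<close>
  define \<phi> where "\<phi> r = (LINT z:D r|lborel. indicat_real (cball 0 1) z)" for r
  have ball_int: "integrable lborel (indicat_real (cball (0 :: real ^ 'n) 1))"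
    using emeasure_bounded_finite[of "cball (0 :: real ^ 'n) 1"] by simp
  have nonneg: "0 \<le> \<phi> r" for r
    unfolding \<phi>_def set_lebesgue_integral_def by (intro integral_nonneg_AE) auto
  have bdd: "\<phi> r \<le> (LINT z|lborel. indicat_real (cball (0 :: real ^ 'n) 1) z)" for r
    unfolding \<phi>_def set_lebesgue_integral_def
    by (intro integral_mono integrable_mult_indicator ball_int D) (auto simp: indicator_def)
  have "(\<phi> \<longlongrightarrow> (LINT z:{}|lborel. indicat_real (cball (0 :: real ^ 'n) 1) z)) (at_right 0)"
    unfolding \<phi>_def[abs_def]
    by (rule tendsto_set_integral_AE_eventually[OF ball_int D])
      (use ev in \<open>auto simp: D_def elim!: eventually_mono\<close>)
  then have "(\<phi> \<longlongrightarrow> 0) (at_right 0)"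
    by (simp add: set_lebesgue_integral_def)
  from exists_slow_scale[OF nonneg bdd this, of "CARD('n)"]
  obtain R where R: "\<forall>t\<in>{0<..<1}. R t > 0" "filterlim R at_top (at_right 0)"
      "((\<lambda>t. sqrt t * R t) \<longlongrightarrow> 0) (at_right 0)"
      "((\<lambda>t. R t ^ CARD('n) * \<phi> (sqrt t * R t)) \<longlongrightarrow> 0) (at_right 0)"
    by (auto simp: Suc_le_eq)
  \<comment> \<open>Scaling by \<rho> maps the unit ball to the ball of radius \<rho> and the
    blow-up of \<open>A\<close> back to \<open>A - p\<close>. The cone property, used with \<rho>
    and with its inverse, shows that \<open>C - p\<close> is unchanged.\<close>
  have scaled: "measure lebesgue
      (sym_diff {w \<in> translate_to_origin p A. norm w \<le> \<rho>} {w \<in> translate_to_origin p C. norm w \<le> \<rho>})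
      = \<rho> ^ CARD('n) * \<phi> \<rho>" (is "measure lebesgue ?X = _") if "\<rho> > 0" for \<rho>
  proof -
    have X: "?X = {w. norm w \<le> \<rho> \<and> (p + w \<in> A) \<noteq> (p + w \<in> C)}"
      unfolding translate_to_origin_eq by auto
    have "?X = cball 0 \<rho> \<inter> sym_diff {w. p + 1 *\<^sub>R w \<in> A} {w. p + 1 *\<^sub>R w \<in> C}"
      unfolding X by auto
    then have [measurable]: "?X \<in> sets borel"
      by (simp only: sets.Int sets.Un sets.Diff sets_borel_affine_preimage borel borel_closed closed_cball)
    have "p + s *\<^sub>R z \<in> C" if "p + z \<in> C" "s > 0" for s z
      using cone that unfolding cone_at_def translate_to_origin_eq by auto
    from this[of _ \<rho>] this[of "\<rho> *\<^sub>R _" "inverse \<rho>"]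
    have C_iff: "p + \<rho> *\<^sub>R z \<in> C \<longleftrightarrow> p + z \<in> C" for z
      using \<open>\<rho> > 0\<close> by auto
    have X_iff: "indicat_real ?X (0 + \<rho> *\<^sub>R z) = indicat_real (D \<rho>) z *\<^sub>R indicat_real (cball 0 1) z" for z
      unfolding X D_def using \<open>\<rho> > 0\<close> by (auto simp: indicator_def C_iff)
    have "measure lebesgue ?X = (LINT w|lborel. indicat_real ?X w)"
      by (simp add: measure_completion)
    also have "\<dots> = \<bar>\<rho>\<bar> ^ DIM(real ^ 'n) *\<^sub>R (LINT z|lborel. indicat_real ?X (0 + \<rho> *\<^sub>R z))"
      using \<open>\<rho> > 0\<close> by (intro lborel_integral_affine) auto
    also have "\<dots> = \<rho> ^ CARD('n) * \<phi> \<rho>"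
      unfolding X_iff \<phi>_def set_lebesgue_integral_def using \<open>\<rho> > 0\<close> by simp
    finally show ?thesis .
  qed
  \<comment> \<open>With \<open>\<rho> = sqrt t * R t\<close> the factor
    \<open>sqrt t ^ CARD('n)\<close> cancels the normalization and leaves the quantity controlled by
    the choice of \<open>R\<close>.\<close>
  have "t powr (- real CARD('n) / 2) * measure lebesgue
      (sym_diff {w \<in> translate_to_origin p A. norm w \<le> sqrt t * R t}
        {w \<in> translate_to_origin p C. norm w \<le> sqrt t * R t})
      = R t ^ CARD('n) * \<phi> (sqrt t * R t)" if "t \<in> {0<..<1}" for t
  proof -
    have "t powr (- real CARD('n) / 2) * sqrt t ^ CARD('n) = 1"
      using that
      by (simp add: powr_half_sqrt[symmetric] powr_realpow[symmetric] powr_powr powr_add[symmetric])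
    then show ?thesis
      using that R(1) by (subst scaled) (auto simp: power_mult_distrib mult.assoc[symmetric])
  qed
  moreover have "\<forall>\<^sub>F t in at_right 0. t \<in> {0<..<1::real}"
    by (rule eventually_at_right_real) simp
  ultimately have "((\<lambda>t. t powr (- real CARD('n) / 2) * measure lebesgue
      (sym_diff {w \<in> translate_to_origin p A. norm w \<le> sqrt t * R t}
        {w \<in> translate_to_origin p C. norm w \<le> sqrt t * R t})) \<longlongrightarrow> 0) (at_right 0)"
    by (intro Lim_transform_eventually[OF R(4)]) (auto elim!: eventually_mono)
  then show ?thesis
    unfolding approximating_cone_def using p C cone R by blast
qed

section \<open>Approximating cone and gradient asymptotics at a corner\<close>

theorem theorem5:
  fixes A U C :: "(real ^ 'n) set" and p :: "real ^ 'n"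
    and \<kappa> \<kappa>' :: "real \<Rightarrow> real" and \<alpha> :: real
    and g :: "nat \<Rightarrow> real ^ 'n \<Rightarrow> real" and k m :: nat and I :: "nat \<Rightarrow> nat set"
  assumes "CARD('n) \<ge> 2"
    and "open A"
    and "\<And>r. r \<ge> 0 \<Longrightarrow> (\<kappa> has_real_derivative \<kappa>' r) (at r within {0..})"
    and "continuous_on {0..} \<kappa>'"
    and "(\<kappa> \<longlongrightarrow> 0) at_top"
    and "(\<integral>\<^sup>+x. ennreal \<bar>\<kappa> ((norm (x :: real ^ 'n))\<^sup>2)\<bar> \<partial>lborel) < \<infinity>"
    and "((\<lambda>r. r * \<kappa>' (r\<^sup>2)) \<longlongrightarrow> 0) at_top"
    and "\<And>K :: (real ^ 'n) set. compact K \<Longrightarrow>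
      (\<integral>\<^sup>+x. (SUP b\<in>K. ennreal (norm (x + b) * \<bar>\<kappa>' ((norm (x + b))\<^sup>2)\<bar>)) \<partial>lborel) < \<infinity>"
    and "0 < \<alpha>" "\<alpha> \<le> 1"
    and "corner_data \<alpha> A p U g k I m"
    and "C = (\<Union>j\<in>{1..m}. {x. \<forall>i\<in>I j. grad (g i) p \<bullet> (x - p) > 0})"
  shows "approximating_cone A p C \<and>
    (\<exists>e :: real \<Rightarrow> real ^ 'n. (e \<longlongrightarrow> 0) (at_right 0) \<and>
      (\<forall>t>0. kernel_integral \<kappa> A t differentiable (at p) \<and>
        grad (kernel_integral \<kappa> A t) p =
          (- 2 / sqrt t) *\<^sub>R
            ((LINT z:translate_to_origin p C|lborel. \<kappa>' ((norm z)\<^sup>2) *\<^sub>R z) + e t)))"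
proof (intro conjI)
  note C = corner_cone[OF assms(11,12)]
  have borel: "A \<in> sets borel" "C \<in> sets borel"
    using assms(2) C(1) by auto
  note ev = corner_blow_up_AE[OF assms(11,12)]
  have "p \<in> frontier A"
    using assms(11) unfolding corner_data_def by simp
  then show "approximating_cone A p C"
    by (rule approximating_cone_of_blow_up[OF _ assms(2) C ev])
  define S where "S r = {z. p + r *\<^sub>R z \<in> A}" for r
  let ?F = "\<lambda>S. LINT z:S|lborel. \<kappa>' ((norm (z :: real ^ 'n))\<^sup>2) *\<^sub>R z"
  have "((\<lambda>r. ?F (S r)) \<longlongrightarrow> ?F (translate_to_origin p C)) (at_right 0)"
  proof (rule tendsto_set_integral_AE_eventually)
    show "integrable lborel (\<lambda>z :: real ^ 'n. \<kappa>' ((norm z)\<^sup>2) *\<^sub>R z)"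
      by (rule integrable_radial_gradient[OF assms(4,8)])
    show "S r \<in> sets lborel" for r
      unfolding S_def by (simp add: sets_borel_affine_preimage borel)
    show "translate_to_origin p C \<in> sets lborel"
      using sets_borel_affine_preimage[OF borel(2), of p 1] by (simp add: translate_to_origin_eq)
    show "AE z in lborel. \<forall>\<^sub>F r in at_right 0. z \<in> S r \<longleftrightarrow> z \<in> translate_to_origin p C"
      using ev by (simp add: S_def translate_to_origin_eq)
  qed
  moreover have "filterlim sqrt (at_right 0) (at_right 0)"
    unfolding filterlim_at
    by (auto simp: eventually_at_right_field intro!: tendsto_eq_intros exI[of _ 1])
  ultimately have "((\<lambda>t. ?F (S (sqrt t))) \<longlongrightarrow> ?F (translate_to_origin p C)) (at_right 0)"
    by (rule filterlim_compose)
  then have "((\<lambda>t. ?F (S (sqrt t)) - ?F (translate_to_origin p C)) \<longlongrightarrow> 0) (at_right 0)"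
    by (rule LIM_zero)
  \<comment> \<open>The error term is exactly the difference of the integrals over
    \<open>(A - p) / sqrt t\<close> and \<open>C - p\<close>, so the identity holds for every
    \<open>t > 0\<close> and only the decay of the error is a limit statement.\<close>
  moreover have "kernel_integral \<kappa> A t differentiable (at p) \<and>
      grad (kernel_integral \<kappa> A t) p = (- 2 / sqrt t) *\<^sub>R
        (?F (translate_to_origin p C) + (?F (S (sqrt t)) - ?F (translate_to_origin p C)))"
    if "t > 0" for t
  proof
    have gd: "GDERIV (kernel_integral \<kappa> A t) p :> (- 2 / sqrt t) *\<^sub>R ?F (S (sqrt t))"
      unfolding S_def by (rule gderiv_kernel_integral[OF borel(1) that assms(3,4,6,8)])
    then show "kernel_integral \<kappa> A t differentiable (at p)"
      unfolding gderiv_def by (rule differentiableI)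
    show "grad (kernel_integral \<kappa> A t) p = (- 2 / sqrt t) *\<^sub>R
        (?F (translate_to_origin p C) + (?F (S (sqrt t)) - ?F (translate_to_origin p C)))"
      using grad_eqI[OF gd] by simp
  qed
  ultimately show "\<exists>e :: real \<Rightarrow> real ^ 'n. (e \<longlongrightarrow> 0) (at_right 0) \<and>
      (\<forall>t>0. kernel_integral \<kappa> A t differentiable (at p) \<and>
        grad (kernel_integral \<kappa> A t) p =
          (- 2 / sqrt t) *\<^sub>R (?F (translate_to_origin p C) + e t))"
    by (intro exI[of _ "\<lambda>t. ?F (S (sqrt t)) - ?F (translate_to_origin p C)"]) auto
qed

end
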